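(* Let $\mathcal{X}\subseteq\mathbb{R}^n$, let $U:\mathbb{R}^n\to\mathbb{R}^N$ be a function, and let $\nu_{\mathbf{w}}$ be the order-based fairness measure with weight vector $\mathbf{w}\in\mathcal{W}$. Then the problem $$\min_{\mathbf{x},\mathbf{u}}\{\nu_{\mathbf{w}}(\mathbf{u})\mid \mathbf{u}=U(\mathbf{x}),\ \mathbf{x}\in\mathcal{X}\}$$ is equivalent to the problem $$\min_{\mathbf{x},\,\mathbf{u},\,\boldsymbol{\lambda}\in\mathbb{R}^N,\,\boldsymbol{\theta}\in\mathbb{R}^N}\Big\{\mathbf{1}^\top(\boldsymbol{\lambda}+\boldsymbol{\theta})\ \Big|\ \lambda_i+\theta_j\ge u_iw_j\ \ \forall i\in[N],\,j\in[N],\ \ \mathbf{u}=U(\mathbf{x}),\ \mathbf{x}\in\mathcal{X}\Big\}.$$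
   Context: $[N]=\{1,\dots,N\}$; $u_{(i)}$ is the $i$th smallest entry of $\mathbf{u}\in\mathbb{R}^N$; $\mathbf{1}$ is the all-ones vector. $\mathcal{W}=\{\mathbf{w}\in\mathbb{R}^N\mid \sum_{i=1}^N w_i=0,\ w_1\le\dots\le w_N,\ w_1<0,\ w_N>0\}$ and $\nu_{\mathbf{w}}(\mathbf{u})=\sum_{i=1}^N w_iu_{(i)}$. "Equivalent" means: the two problems have the same optimal value (infimum in the extended reals), and $(\mathbf{x},\mathbf{u})$ is optimal for the first problem if and only if there exist $\boldsymbol{\lambda},\boldsymbol{\theta}\in\mathbb{R}^N$ such that $(\mathbf{x},\mathbf{u},\boldsymbol{\lambda},\boldsymbol{\theta})$ is optimal for the second. *)

theory Defs
  imports "Jordan_Normal_Form.Matrix" "HOL-Library.Extended_Real"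
begin

text \<open>
  Vectors of \<open>\<real>\<^sup>N\<close> are the elements of \<open>carrier_vec N\<close>, whose entries are indexed from \<open>0\<close>:
  the mathematical \<open>u\<^sub>i\<close>, \<open>1 \<le> i \<le> N\<close>, is \<open>u $ (i - 1)\<close>.
\<close>

text \<open>Also indexed from \<open>0\<close>: \<open>order_stat u i\<close> is the \<open>(i + 1)\<close>-th smallest entry of \<open>u\<close>,
  counted with multiplicity.\<close>

definition order_stat :: "real vec \<Rightarrow> nat \<Rightarrow> real" where
  "order_stat u i = sort (list_of_vec u) ! i"

text \<open>For \<open>N = 0\<close> the two strict inequalities concern the same term, so the set is empty.\<close>

definition weights :: "nat \<Rightarrow> real vec set" where
  "weights N = {w \<in> carrier_vec N.
     (\<Sum>i<N. w $ i) = 0 \<and> (\<forall>i. Suc i < N \<longrightarrow> w $ i \<le> w $ Suc i) \<and>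
     w $ 0 < 0 \<and> 0 < w $ (N - 1)}"

definition fairness :: "real vec \<Rightarrow> real vec \<Rightarrow> real" where
  "fairness w u = (\<Sum>i<dim_vec w. w $ i * order_stat u i)"

definition ones_vec :: "nat \<Rightarrow> real vec" where
  "ones_vec N = vec N (\<lambda>_. 1)"

text \<open>Minimization of a real objective over a feasible set. The value lives in \<open>ereal\<close>:
  it is \<open>\<infinity>\<close> if the problem is infeasible and \<open>-\<infinity>\<close> if it is unbounded.\<close>

definition optimal_value :: "('a \<Rightarrow> real) \<Rightarrow> 'a set \<Rightarrow> ereal" where
  "optimal_value f S = (INF z\<in>S. ereal (f z))"

definition optimal :: "('a \<Rightarrow> real) \<Rightarrow> 'a set \<Rightarrow> 'a \<Rightarrow> bool" where
  "optimal f S z \<longleftrightarrow> is_arg_min f (\<lambda>y. y \<in> S) z"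

definition equivalent_problems ::
  "nat \<Rightarrow> (real vec \<times> real vec \<Rightarrow> real) \<Rightarrow> (real vec \<times> real vec) set \<Rightarrow>
   (real vec \<times> real vec \<times> real vec \<times> real vec \<Rightarrow> real) \<Rightarrow>
   (real vec \<times> real vec \<times> real vec \<times> real vec) set \<Rightarrow> bool" where
  "equivalent_problems N f S g T \<longleftrightarrow>
     optimal_value f S = optimal_value g T \<and>
     (\<forall>x u. optimal f S (x, u) \<longleftrightarrow>
        (\<exists>l \<in> carrier_vec N. \<exists>t \<in> carrier_vec N. optimal g T (x, u, l, t)))"

end

theory Submission
  imports Defs "HOL-Combinatorics.Permutations"
begin

text \<open>
  For fixed \<open>u\<close> the inner problem is the dual of the assignment problem with gains
  \<open>u\<^sub>i w\<^sub>j\<close>. Adding the constraints along a permutation that sorts \<open>u\<close> gives weak duality.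
  The bound is attained by potentials that telescope along the sorted order: with
  \<open>s\<close> the sorted entries, take \<open>\<lambda>\<^sub>i = \<Sum>\<^sub>k\<^sub><\<^sub>i w\<^sub>k (s\<^sub>k\<^sub>+\<^sub>1 - s\<^sub>k)\<close> and \<open>\<theta>\<^sub>j = s\<^sub>j w\<^sub>j - \<lambda>\<^sub>j\<close>;
  feasibility then amounts to bounding each \<open>w\<^sub>k\<close> between \<open>i\<close> and \<open>j\<close> by \<open>w\<^sub>j\<close>.
\<close>

text \<open>Minimization in two stages: \<open>proj\<close> makes \<open>f\<close> a lower bound for
  \<open>g\<close> over each point of \<open>S\<close>, and \<open>attained\<close> makes this bound
  a minimum, so values and minimizers transfer in both directions.\<close>

lemma equivalent_problemsI:
  assumes proj: "\<And>x u l t. (x, u, l, t) \<in> T \<Longrightarrow>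
      (x, u) \<in> S \<and> l \<in> carrier_vec N \<and> t \<in> carrier_vec N \<and> f (x, u) \<le> g (x, u, l, t)"
    and attained: "\<And>x u. (x, u) \<in> S \<Longrightarrow> \<exists>l t. (x, u, l, t) \<in> T \<and> g (x, u, l, t) = f (x, u)"
  shows "equivalent_problems N f S g T"
proof -
  have "optimal_value f S = optimal_value g T"
    unfolding optimal_value_def
  proof (intro antisym INF_greatest)
    fix z assume "z \<in> T"
    then obtain x u l t where "z = (x, u, l, t)" "(x, u, l, t) \<in> T" by (cases z) auto
    then show "(INF z\<in>S. ereal (f z)) \<le> ereal (g z)"
      using proj[of x u l t] by (auto intro: INF_lower2)
  next
    fix z assume "z \<in> S"
    then obtain x u l t where "z = (x, u)" "(x, u, l, t) \<in> T" "g (x, u, l, t) = f (x, u)"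
      using attained by (cases z) blast
    then show "(INF z\<in>T. ereal (g z)) \<le> ereal (f z)"
      by (auto intro: INF_lower2)
  qed
  moreover have "optimal f S (x, u) \<longleftrightarrow>
      (\<exists>l \<in> carrier_vec N. \<exists>t \<in> carrier_vec N. optimal g T (x, u, l, t))" for x u
  proof
    assume opt: "optimal f S (x, u)"
    then obtain l t where lt: "(x, u, l, t) \<in> T" "g (x, u, l, t) = f (x, u)"
      using attained[of x u] by (auto simp: optimal_def is_arg_min_linorder)
    have "g (x, u, l, t) \<le> g (x', u', l', t')" if "(x', u', l', t') \<in> T" for x' u' l' t'
    proof -
      have "f (x, u) \<le> f (x', u')"
        using opt proj[OF that] by (simp add: optimal_def is_arg_min_linorder)
      then show ?thesis using lt(2) proj[OF that] by linarith
    qed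
    then have "optimal g T (x, u, l, t)"
      using lt(1) by (auto simp: optimal_def is_arg_min_linorder)
    then show "\<exists>l \<in> carrier_vec N. \<exists>t \<in> carrier_vec N. optimal g T (x, u, l, t)"
      using proj[OF lt(1)] by blast
  next
    assume "\<exists>l \<in> carrier_vec N. \<exists>t \<in> carrier_vec N. optimal g T (x, u, l, t)"
    then obtain l t where opt: "optimal g T (x, u, l, t)" by blast
    then have T: "(x, u, l, t) \<in> T" by (simp add: optimal_def is_arg_min_linorder)
    have "f (x, u) \<le> f (x', u')" if S: "(x', u') \<in> S" for x' u'
    proof -
      obtain l' t' where lt': "(x', u', l', t') \<in> T" "g (x', u', l', t') = f (x', u')"
        using attained[OF S] by blast
      have "g (x, u, l, t) \<le> g (x', u', l', t')"
        using opt lt'(1) by (auto simp: optimal_def is_arg_min_linorder)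
      then show ?thesis using lt'(2) proj[OF T] by linarith
    qed
    then show "optimal f S (x, u)"
      using proj[OF T] by (auto simp: optimal_def is_arg_min_linorder)
  qed
  ultimately show ?thesis by (simp add: equivalent_problems_def)
qed

lemma sort_permutation:
  assumes "u \<in> carrier_vec N"
  obtains p where "p permutes {..<N}" "\<And>i. i < N \<Longrightarrow> order_stat u i = u $ p i"
proof -
  have len: "length (list_of_vec u) = N" using assms by simp
  obtain p where p: "p permutes {..<N}" "permute_list p (list_of_vec u) = sort (list_of_vec u)"
    using mset_eq_permutation[of "sort (list_of_vec u)" "list_of_vec u"] len by auto
  have "order_stat u i = u $ p i" if "i < N" for i
  proof -
    have "order_stat u i = list_of_vec u ! p i"
      using p that len permute_list_nth[of p "list_of_vec u" i] by (simp add: order_stat_def)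
    then show ?thesis
      using permutes_in_image[OF p(1), of i] that assms by (simp add: list_of_vec_index)
  qed
  then show thesis using p(1) that by blast
qed

lemma order_stat_mono:
  assumes "u \<in> carrier_vec N" "i \<le> j" "j < N"
  shows "order_stat u i \<le> order_stat u j"
  using assms by (auto simp: order_stat_def intro!: sorted_nth_mono)

lemma weights_mono:
  assumes "w \<in> weights N" "i \<le> j" "j < N"
  shows "w $ i \<le> w $ j"
  using assms(2,3)
proof (induction rule: dec_induct)
  case (step k)
  then show ?case using assms(1) by (force simp: weights_def)
qed simp

lemma ones_vec_scalar_prod_add:
  assumes "l \<in> carrier_vec N" "t \<in> carrier_vec N"
  shows "ones_vec N \<bullet> (l + t) = (\<Sum>i<N. l $ i) + (\<Sum>i<N. t $ i)"
  using assms by (auto simp: scalar_prod_def ones_vec_def sum.distrib lessThan_atLeast0)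

lemma fairness_le_dual:
  assumes w: "w \<in> weights N" and u: "u \<in> carrier_vec N"
    and l: "l \<in> carrier_vec N" and t: "t \<in> carrier_vec N"
    and feas: "\<And>i j. i < N \<Longrightarrow> j < N \<Longrightarrow> u $ i * w $ j \<le> l $ i + t $ j"
  shows "fairness w u \<le> ones_vec N \<bullet> (l + t)"
proof -
  obtain p where p: "p permutes {..<N}" "\<And>i. i < N \<Longrightarrow> order_stat u i = u $ p i"
    using sort_permutation[OF u] by blast
  have p_less: "p i < N" if "i < N" for i
    using permutes_in_image[OF p(1), of i] that by simp
  have "fairness w u = (\<Sum>i<N. u $ p i * w $ i)"
    using w p(2) by (auto simp: fairness_def weights_def mult.commute intro!: sum.cong)
  \<comment> \<open>Of all the constraints, only the \<open>N\<close> pairs \<open>(p i, i)\<close>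
    enter; since \<open>p\<close> is a bijection, each \<open>l\<close> entry and each
    \<open>t\<close> entry is counted exactly once.\<close>
  also have "\<dots> \<le> (\<Sum>i<N. l $ p i + t $ i)"
    using feas p_less by (intro sum_mono) auto
  also have "\<dots> = (\<Sum>i<N. l $ i) + (\<Sum>i<N. t $ i)"
    using sum.permute[OF p(1), of "\<lambda>i. l $ i"] by (simp add: sum.distrib comp_def)
  finally show ?thesis using ones_vec_scalar_prod_add[OF l t] by simp
qed

text \<open>The difference of the two prefix sums runs over \<open>i \<le> k < j\<close>, where each
  nonnegative increment of \<open>s\<close> has weight at least \<open>c\<close>; the unweighted
  increments telescope. The sign of \<open>c\<close> is arbitrary.\<close>

lemma sum_increments_ge:
  fixes s v :: "nat \<Rightarrow> real"
  assumes "i \<le> j" "\<And>k. i \<le> k \<Longrightarrow> k < j \<Longrightarrow> s k \<le> s (Suc k) \<and> c \<le> v k"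
  shows "c * (s j - s i) \<le> (\<Sum>k<j. v k * (s (Suc k) - s k)) - (\<Sum>k<i. v k * (s (Suc k) - s k))"
  using assms
proof (induction rule: dec_induct)
  case (step j)
  have "c * (s (Suc j) - s j) \<le> v j * (s (Suc j) - s j)"
    using step.prems[of j] step.hyps by (intro mult_right_mono) auto
  then show ?case using step.IH step.prems by (fastforce simp: algebra_simps)
qed simp

text \<open>Rearranged, the claim is \<open>v j * (s i - s j) \<le> \<phi> i - \<phi> j\<close>. For
  \<open>j \<le> i\<close> the weights in between are at least \<open>v j\<close>; for
  \<open>i < j\<close> they are at most \<open>v j\<close>, but the sum enters with a minus
  sign.\<close>

lemma sorted_potential:
  fixes s v :: "nat \<Rightarrow> real"
  assumes s: "\<And>i j. i \<le> j \<Longrightarrow> j < N \<Longrightarrow> s i \<le> s j"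
    and v: "\<And>i j. i \<le> j \<Longrightarrow> j < N \<Longrightarrow> v i \<le> v j"
    and less: "i < N" "j < N"
  defines "\<phi> \<equiv> \<lambda>i. \<Sum>k<i. v k * (s (Suc k) - s k)"
  shows "s i * v j \<le> \<phi> i + (s j * v j - \<phi> j)"
proof (cases "j \<le> i")
  case True
  have "v j * (s i - s j) \<le> \<phi> i - \<phi> j"
    unfolding \<phi>_def using True less by (intro sum_increments_ge) (auto intro: s v)
  then show ?thesis by (simp add: algebra_simps)
next
  case False
  \<comment> \<open>The upper bound on the increments is the lower bound for the negated weights.\<close>
  have "- v j * (s j - s i) \<le> (\<Sum>k<j. - v k * (s (Suc k) - s k)) - (\<Sum>k<i. - v k * (s (Suc k) - s k))"
    using False less by (intro sum_increments_ge) (auto intro: s v)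
  then show ?thesis by (simp only: mult_minus_left sum_negf \<phi>_def) (simp add: right_diff_distrib mult.commute)
qed

lemma dual_attains_fairness:
  assumes w: "w \<in> weights N" and u: "u \<in> carrier_vec N"
  obtains l t where "l \<in> carrier_vec N" "t \<in> carrier_vec N"
    "\<And>i j. i < N \<Longrightarrow> j < N \<Longrightarrow> u $ i * w $ j \<le> l $ i + t $ j"
    "ones_vec N \<bullet> (l + t) = fairness w u"
proof -
  obtain p where p: "p permutes {..<N}" "\<And>i. i < N \<Longrightarrow> order_stat u i = u $ p i"
    using sort_permutation[OF u] by blast
  \<comment> \<open>\<open>p\<close> maps ranks to positions in \<open>u\<close>, so
    \<open>q i\<close> is the rank of the entry \<open>u $ i\<close>, with ties broken by
    \<open>p\<close>.\<close>
  define q where "q = inv_into UNIV p"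
  have q: "q permutes {..<N}" unfolding q_def by (rule permutes_inv[OF p(1)])
  have q_less: "q i < N" if "i < N" for i
    using permutes_in_image[OF q, of i] that by simp
  have u_eq: "order_stat u (q i) = u $ i" if "i < N" for i
    using p(2)[OF q_less[OF that]] permutes_inverses(1)[OF p(1)] by (simp add: q_def)
  \<comment> \<open>For \<open>i < N\<close> the largest rank read is \<open>i\<close>, so
    \<open>order_stat u\<close> is never evaluated out of range.\<close>
  define \<phi> where "\<phi> i = (\<Sum>k<i. w $ k * (order_stat u (Suc k) - order_stat u k))" for i
  \<comment> \<open>\<open>l\<close> is indexed by positions in \<open>u\<close> and must pass
    through the rank; \<open>t\<close> is indexed like \<open>w\<close>, which is already in sorted
    order.\<close>
  define l where "l = vec N (\<lambda>i. \<phi> (q i))"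
  define t where "t = vec N (\<lambda>j. order_stat u j * w $ j - \<phi> j)"
  show thesis
  proof
    show l: "l \<in> carrier_vec N" and t: "t \<in> carrier_vec N" by (simp_all add: l_def t_def)
    show "u $ i * w $ j \<le> l $ i + t $ j" if "i < N" "j < N" for i j
      using sorted_potential[of N "order_stat u" "\<lambda>k. w $ k" "q i" j]
        order_stat_mono[OF u] weights_mono[OF w] q_less u_eq that
      by (simp add: l_def t_def \<phi>_def)
    \<comment> \<open>Reindexing by \<open>q\<close> preserves the total, so the potentials in
      \<open>l\<close> cancel those subtracted in \<open>t\<close>.\<close>
    have "(\<Sum>i<N. l $ i) = (\<Sum>i<N. \<phi> i)"
      using sum.permute[OF q, of \<phi>] by (simp add: l_def comp_def)
    then have "ones_vec N \<bullet> (l + t) = (\<Sum>j<N. order_stat u j * w $ j)"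
      using ones_vec_scalar_prod_add[OF l t] by (simp add: t_def sum_subtractf)
    then show "ones_vec N \<bullet> (l + t) = fairness w u"
      using w by (auto simp: fairness_def weights_def mult.commute)
  qed
qed

theorem theorem5:
  fixes n N :: nat
    and X :: "real vec set"
    and U :: "real vec \<Rightarrow> real vec"
    and w :: "real vec"
  assumes "X \<subseteq> carrier_vec n"
    and "U \<in> carrier_vec n \<rightarrow> carrier_vec N"
    and "w \<in> weights N"
  shows "equivalent_problems N
    (\<lambda>(x, u). fairness w u)
    {(x, u). u = U x \<and> x \<in> X}
    (\<lambda>(x, u, l, t). ones_vec N \<bullet> (l + t))
    {(x, u, l, t). l \<in> carrier_vec N \<and> t \<in> carrier_vec N \<and>
       (\<forall>i<N. \<forall>j<N. l $ i + t $ j \<ge> u $ i * w $ j) \<and> u = U x \<and> x \<in> X}"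
proof (rule equivalent_problemsI, goal_cases)
  case (1 x u l t)
  then have "u \<in> carrier_vec N" using assms(1,2) by auto
  then show ?case using 1 fairness_le_dual[OF assms(3), of u l t] by auto
next
  case (2 x u)
  then have "u \<in> carrier_vec N" using assms(1,2) by auto
  then obtain l t where "l \<in> carrier_vec N" "t \<in> carrier_vec N"
      "\<And>i j. i < N \<Longrightarrow> j < N \<Longrightarrow> u $ i * w $ j \<le> l $ i + t $ j"
      "ones_vec N \<bullet> (l + t) = fairness w u"
    using dual_attains_fairness[OF assms(3)] by blast
  then show ?case using 2 by auto
qed

end
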